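(* (i) Every convergent sequence of multigraphons is tight. (ii) Every tight sequence of multigraphons contains a convergent subsequence.
   Context: $\mathbb{N}_0=\{0,1,2,\dots\}$, $[k]=\{1,\dots,k\}$. **Multigraphs.** $\mathcal{M}$ is the set of isomorphism types of finite undirected multigraphs (multiple edges and loops allowed). For a labeling of the vertices by $[k]$, the adjacency matrix $A$ has $A(i,j)$ = number of edges between $i$ and $j$ for $i\neq j$, and $A(i,i)$ = twice the number of loops at $i$. $\mathcal{A}_k=\{A\in\mathbb{N}_0^{k\times k}: A^T=A,\ A(i,i)\text{ even for all } i\}$ and $e(A)=\frac12\sum_{i,j=1}^kA(i,j)$. For $f:\mathcal{M}\to\mathbb{R}$ write $f(A):=f(F)$ if $A$ is the adjacency matrix of a labeling of $F$; $f$ is *non-defective* if for every $k$ and every sequence $A_1,A_2,\dots\in\mathcal{A}_k$ with $e(A_n)\to\infty$, one has $f(A_n)\to0$. **Multigraphons.** A multigraphon is a Borel measurable function $W:[0,1]\times[0,1]\times\mathbb{N}_0\to[0,1]$ with, for all $x,y\in[0,1]$ and $k\in\mathbb{N}_0$: $W(x,y,k)=W(y,x,k)$; $\sum_{k=0}^\infty W(x,y,k)=1$; $W(x,x,2k+1)=0$. For $F\in\mathcal{M}$ with adjacency matrix $A\in\mathcal{A}_k$, $$t_{\leq}(F,W)=\int_{[0,1]^k}\prod_{1\le i\leq j\leq k}\ \sum_{l=A(i,j)}^{\infty}W(x_i,x_j,l)\,dx_1\cdots dx_k .$$ **Convergence.** A sequence $(W_n)_{n=1}^\infty$ of multigraphons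 is *convergent* if the limit $f(F)=\lim_{n\to\infty}t_{\leq}(F,W_n)$ exists for every $F\in\mathcal{M}$ and the resulting function $f$ is non-defective. **Tightness.** A sequence $(W_n)_{n=1}^\infty$ of multigraphons is *tight* if $$\lim_{m\to\infty}\sup_n\int_0^1\!\int_0^1\sum_{k=m}^\infty W_n(x,y,k)\,dx\,dy=0\quad\text{and}\quad \lim_{m\to\infty}\sup_n\int_0^1\sum_{k=m}^\infty W_n(x,x,k)\,dx=0 .$$ *)

theory Defs
  imports "HOL-Analysis.Analysis" "HOL-Library.Uprod" "HOL-Probability.Infinite_Product_Measure"
begin

section \<open>Isomorphism types of finite multigraphs\<close>

text \<open>A multigraph is a finite vertex set together with a finite multiset of unordered pairs
  (a loop at \<open>v\<close> is \<open>Upair v v\<close>).  Vertices are taken from \<open>nat\<close>, which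
  represents every isomorphism type of finite multigraphs.\<close>

type_synonym labelled_multigraph = "nat set \<times> nat uprod multiset"

definition multigraph :: "labelled_multigraph \<Rightarrow> bool" where
  "multigraph G \<longleftrightarrow> finite (fst G) \<and> (\<forall>e\<in>#snd G. set_uprod e \<subseteq> fst G)"

definition multigraph_iso :: "labelled_multigraph \<Rightarrow> labelled_multigraph \<Rightarrow> bool" where
  "multigraph_iso G H \<longleftrightarrow> multigraph G \<and> multigraph H \<and>
     (\<exists>\<phi>. bij_betw \<phi> (fst G) (fst H) \<and> image_mset (map_uprod \<phi>) (snd G) = snd H)"

lemma multigraph_iso_refl: "multigraph G \<Longrightarrow> multigraph_iso G G"
  unfolding multigraph_iso_def
  by (intro conjI exI[of _ id]) (auto simp: uprod.map_id0)

lemma multigraph_iso_sym: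
  assumes "multigraph_iso G H"
  shows "multigraph_iso H G"
proof -
  from assms obtain \<phi> where G: "multigraph G" and H: "multigraph H"
    and b: "bij_betw \<phi> (fst G) (fst H)" and e: "image_mset (map_uprod \<phi>) (snd G) = snd H"
    by (auto simp: multigraph_iso_def)
  let ?\<psi> = "inv_into (fst G) \<phi>"
  have "image_mset (map_uprod ?\<psi>) (snd H) = image_mset (\<lambda>e. map_uprod (?\<psi> \<circ> \<phi>) e) (snd G)"
    unfolding e[symmetric] by (simp add: multiset.map_comp comp_def uprod.map_comp)
  also have "\<dots> = image_mset (\<lambda>e. e) (snd G)"
  proof (rule image_mset_cong)
    fix e assume "e \<in># snd G"
    then have "set_uprod e \<subseteq> fst G" using G by (auto simp: multigraph_def)
    then have "map_uprod (?\<psi> \<circ> \<phi>) e = map_uprod id e"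
      using b by (intro uprod.map_cong refl) (auto simp: bij_betw_def)
    then show "map_uprod (?\<psi> \<circ> \<phi>) e = e" by (simp add: uprod.map_id0)
  qed
  finally have "image_mset (map_uprod ?\<psi>) (snd H) = snd G" by simp
  then show ?thesis
    using G H bij_betw_inv_into[OF b] by (auto simp: multigraph_iso_def)
qed

lemma multigraph_iso_trans:
  assumes "multigraph_iso G H" "multigraph_iso H K"
  shows "multigraph_iso G K"
proof -
  from assms obtain \<phi> \<psi> where "multigraph G" "multigraph K"
    and "bij_betw \<phi> (fst G) (fst H)" and e: "image_mset (map_uprod \<phi>) (snd G) = snd H"
    and "bij_betw \<psi> (fst H) (fst K)" and e': "image_mset (map_uprod \<psi>) (snd H) = snd K"
    by (auto simp: multigraph_iso_def)
  moreover have "image_mset (map_uprod (\<psi> \<circ> \<phi>)) (snd G) = snd K"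
    unfolding e'[symmetric] e[symmetric]
    by (simp add: multiset.map_comp comp_def uprod.map_comp)
  ultimately show ?thesis
    unfolding multigraph_iso_def by (metis bij_betw_trans)
qed

quotient_type mgraph = labelled_multigraph / partial: multigraph_iso
proof (rule part_equivpI)
  have "multigraph ({}, {#})" by (simp add: multigraph_def)
  then show "\<exists>G. multigraph_iso G G" using multigraph_iso_refl by blast
  show "symp multigraph_iso" by (rule sympI, rule multigraph_iso_sym)
  show "transp multigraph_iso" by (rule transpI, rule multigraph_iso_trans)
qed

section \<open>Adjacency matrices\<close>

definition adj :: "labelled_multigraph \<Rightarrow> nat \<Rightarrow> nat \<Rightarrow> nat" where
  "adj G u v = (if u = v then 2 * count (snd G) (Upair u u) else count (snd G) (Upair u v))"

text \<open>Matrices of size \<open>k\<close> are functions of which only the entries with indices in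
  \<open>{1..k}\<close> matter.\<close>

definition adj_matrices :: "nat \<Rightarrow> (nat \<Rightarrow> nat \<Rightarrow> nat) set" where
  "adj_matrices k = {A. (\<forall>i\<in>{1..k}. \<forall>j\<in>{1..k}. A i j = A j i) \<and> (\<forall>i\<in>{1..k}. even (A i i))}"

definition edge_count :: "nat \<Rightarrow> (nat \<Rightarrow> nat \<Rightarrow> nat) \<Rightarrow> real" where
  "edge_count k A = (1/2) * (\<Sum>i=1..k. \<Sum>j=1..k. real (A i j))"

definition is_adj_matrix :: "nat \<Rightarrow> (nat \<Rightarrow> nat \<Rightarrow> nat) \<Rightarrow> mgraph \<Rightarrow> bool" where
  "is_adj_matrix k A F \<longleftrightarrow>
     (\<exists>G l. multigraph G \<and> abs_mgraph G = F \<and> bij_betw l {1..k} (fst G) \<and>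
        (\<forall>i\<in>{1..k}. \<forall>j\<in>{1..k}. A i j = adj G (l i) (l j)))"


lemma is_adj_matrix_imp_adj_matrices: "is_adj_matrix k A F \<Longrightarrow> A \<in> adj_matrices k"
proof -
  have "adj G u v = adj G v u" "even (adj G u u)" for G u v
    by (simp_all add: adj_def) (metis Upair_inject)
  then show "is_adj_matrix k A F \<Longrightarrow> A \<in> adj_matrices k"
    unfolding is_adj_matrix_def adj_matrices_def mem_Collect_eq by metis
qed

lemma ex_is_adj_matrix: "\<exists>k A. is_adj_matrix k A F"
proof -
  obtain G where G: "multigraph G" "abs_mgraph G = F"
    using Quotient_abs_rep[OF Quotient_mgraph] Quotient_rep_reflp[OF Quotient_mgraph]
    by (metis multigraph_iso_def)
  then have "finite (fst G)" by (simp add: multigraph_def)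
  then obtain l where "bij_betw l {1..card (fst G)} (fst G)"
    using ex_bij_betw_nat_finite_1 by blast
  with G show ?thesis
    unfolding is_adj_matrix_def
    by (intro exI[of _ "card (fst G)"] exI[of _ "\<lambda>i j. adj G (l i) (l j)"] exI[of _ G] exI[of _ l])
       auto
qed

lemma count_image_map_uprod:
  assumes G: "\<forall>e\<in>#E. set_uprod e \<subseteq> V" and inj: "inj_on \<phi> V" and uv: "u \<in> V" "v \<in> V"
  shows "count (image_mset (map_uprod \<phi>) E) (Upair (\<phi> u) (\<phi> v)) = count E (Upair u v)"
proof -
  have "{e. e \<in># E \<and> Upair (\<phi> u) (\<phi> v) = map_uprod \<phi> e} = (if Upair u v \<in># E then {Upair u v} else {})"
  proof -
    have "e = Upair u v" if "e \<in># E" "Upair (\<phi> u) (\<phi> v) = map_uprod \<phi> e" for e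
      using that G uv inj by (cases e) (auto simp: inj_on_def)
    moreover have "map_uprod \<phi> (Upair u v) = Upair (\<phi> u) (\<phi> v)" by simp
    ultimately have "(e \<in># E \<and> Upair (\<phi> u) (\<phi> v) = map_uprod \<phi> e) \<longleftrightarrow> (e = Upair u v \<and> Upair u v \<in># E)" for e
      by metis
    then show ?thesis by (simp del: Upair_inject)
  qed
  then show ?thesis by (simp add: count_image_mset' not_in_iff del: Upair_inject)
qed

lemma multigraph_iso_iff_adj:
  assumes G: "multigraph G" and H: "multigraph H" and b: "bij_betw \<phi> (fst G) (fst H)"
  shows "image_mset (map_uprod \<phi>) (snd G) = snd H \<longleftrightarrow>
    (\<forall>u\<in>fst G. \<forall>v\<in>fst G. adj H (\<phi> u) (\<phi> v) = adj G u v)" (is "?l \<longleftrightarrow> ?r")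
proof -
  have c: "count (image_mset (map_uprod \<phi>) (snd G)) (Upair (\<phi> u) (\<phi> v)) = count (snd G) (Upair u v)"
    if "u \<in> fst G" "v \<in> fst G" for u v
    using G b that by (intro count_image_map_uprod[where V = "fst G"]) (auto simp: multigraph_def bij_betw_def)
  have i: "\<phi> u = \<phi> v \<longleftrightarrow> u = v" if "u \<in> fst G" "v \<in> fst G" for u v
    using b that by (auto simp: bij_betw_def inj_on_def)
  show ?thesis
  proof
    assume l: ?l
    show ?r
      using c i by (auto simp: adj_def l[symmetric])
  next
    assume r: ?r
    have r': "count (snd H) (Upair (\<phi> u) (\<phi> v)) = count (snd G) (Upair u v)"
      if "u \<in> fst G" "v \<in> fst G" for u v
      using r[rule_format, OF that] i[OF that] by (cases "u = v") (simp_all add: adj_def)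
    show ?l
    proof (rule multiset_eqI)
      fix e :: "nat uprod"
      show "count (image_mset (map_uprod \<phi>) (snd G)) e = count (snd H) e"
      proof (cases "set_uprod e \<subseteq> fst H")
        case True
        obtain a d where e: "e = Upair a d" by (cases e)
        with True have "a \<in> \<phi> ` fst G" "d \<in> \<phi> ` fst G"
          using b by (auto simp: bij_betw_def)
        then obtain u v where "u \<in> fst G" "v \<in> fst G" "a = \<phi> u" "d = \<phi> v"
          by blast
        with c r' e show ?thesis by simp
      next
        case False
        then have "e \<notin># snd H" using H by (auto simp: multigraph_def)
        moreover have "e \<notin># image_mset (map_uprod \<phi>) (snd G)"
          using G b False by (fastforce simp: multigraph_def bij_betw_def uprod.set_map)
        ultimately show ?thesis unfolding not_in_iff by simp
      qed
    qed
  qed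
qed

lemma abs_mgraph_eq_iff:
  "multigraph G \<Longrightarrow> multigraph H \<Longrightarrow> abs_mgraph G = abs_mgraph H \<longleftrightarrow> multigraph_iso G H"
  using Quotient_rel[OF Quotient_mgraph] multigraph_iso_refl by blast

lemma is_adj_matrix_unique:
  assumes "is_adj_matrix k A F" "is_adj_matrix k A F'"
  shows "F = F'"
proof -
  from assms obtain G l G' l' where G: "multigraph G" "abs_mgraph G = F" "multigraph G'" "abs_mgraph G' = F'"
    and l: "bij_betw l {1..k} (fst G)" and l': "bij_betw l' {1..k} (fst G')"
    and A: "\<And>i j. i \<in> {1..k} \<Longrightarrow> j \<in> {1..k} \<Longrightarrow> A i j = adj G (l i) (l j)"
    and A': "\<And>i j. i \<in> {1..k} \<Longrightarrow> j \<in> {1..k} \<Longrightarrow> A i j = adj G' (l' i) (l' j)"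
    unfolding is_adj_matrix_def by metis
  let ?m = "inv_into {1..k} l"
  have m: "bij_betw ?m (fst G) {1..k}" using l by (rule bij_betw_inv_into)
  have b: "bij_betw (l' \<circ> ?m) (fst G) (fst G')" using m l' by (rule bij_betw_trans)
  have "\<forall>u\<in>fst G. \<forall>v\<in>fst G. adj G' ((l' \<circ> ?m) u) ((l' \<circ> ?m) v) = adj G u v"
  proof (intro ballI)
    fix u v assume uv: "u \<in> fst G" "v \<in> fst G"
    then have "?m u \<in> {1..k}" "?m v \<in> {1..k}" using m by (auto simp: bij_betw_def)
    moreover have "l (?m u) = u" "l (?m v) = v"
      using uv l by (auto simp: bij_betw_def f_inv_into_f)
    ultimately show "adj G' ((l' \<circ> ?m) u) ((l' \<circ> ?m) v) = adj G u v"
      using A[of "?m u" "?m v"] A'[of "?m u" "?m v"] by simp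
  qed
  with b G have "multigraph_iso G G'"
    unfolding multigraph_iso_def using multigraph_iso_iff_adj[of G G'] by blast
  with G abs_mgraph_eq_iff show ?thesis by blast
qed

lemma is_adj_matrix_relabel:
  assumes "is_adj_matrix k A F" "is_adj_matrix m B F"
  shows "m = k \<and> (\<exists>p. bij_betw p {1..k} {1..k} \<and> (\<forall>i\<in>{1..k}. \<forall>j\<in>{1..k}. B i j = A (p i) (p j)))"
proof -
  from assms obtain G l G' l' where G: "multigraph G" "multigraph G'" "abs_mgraph G = abs_mgraph G'"
    and l: "bij_betw l {1..k} (fst G)" and l': "bij_betw l' {1..m} (fst G')"
    and A: "\<And>i j. i \<in> {1..k} \<Longrightarrow> j \<in> {1..k} \<Longrightarrow> A i j = adj G (l i) (l j)"
    and B: "\<And>i j. i \<in> {1..m} \<Longrightarrow> j \<in> {1..m} \<Longrightarrow> B i j = adj G' (l' i) (l' j)"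
    unfolding is_adj_matrix_def by metis
  then have "multigraph_iso G' G" using abs_mgraph_eq_iff by metis
  then obtain \<phi> where b: "bij_betw \<phi> (fst G') (fst G)"
    and e: "\<forall>u\<in>fst G'. \<forall>v\<in>fst G'. adj G (\<phi> u) (\<phi> v) = adj G' u v"
    unfolding multigraph_iso_def using multigraph_iso_iff_adj by metis
  let ?m = "inv_into {1..k} l"
  let ?p = "?m \<circ> (\<phi> \<circ> l')"
  have m: "bij_betw ?m (fst G) {1..k}" using l by (rule bij_betw_inv_into)
  have p: "bij_betw ?p {1..m} {1..k}"
    by (rule bij_betw_trans[OF bij_betw_trans[OF l' b] m])
  then have "m = k" using bij_betw_same_card by fastforce
  moreover have "B i j = A (?p i) (?p j)" if ij: "i \<in> {1..k}" "j \<in> {1..k}" for i j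
  proof -
    have "l' i \<in> fst G'" "l' j \<in> fst G'" using ij l' \<open>m = k\<close> by (auto simp: bij_betw_def)
    then have fg: "\<phi> (l' i) \<in> fst G" "\<phi> (l' j) \<in> fst G" using b by (auto simp: bij_betw_def)
    then have "l (?p i) = \<phi> (l' i)" "l (?p j) = \<phi> (l' j)"
      using l by (auto simp: bij_betw_def f_inv_into_f)
    moreover have "?p i \<in> {1..k}" "?p j \<in> {1..k}" using fg m by (auto simp: bij_betw_def)
    ultimately show ?thesis
      using A[of "?p i" "?p j"] B[of i j] ij \<open>m = k\<close> e \<open>l' i \<in> fst G'\<close> \<open>l' j \<in> fst G'\<close> by simp
  qed
  ultimately show ?thesis using p by blast
qed

lemma ex_mgraph_of_adj_matrix:
  assumes "A \<in> adj_matrices k"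
  shows "\<exists>F. is_adj_matrix k A F"
proof -
  define P where "P = {(i, j). i \<in> {1..k} \<and> j \<in> {1..k} \<and> i \<le> j}"
  have fP: "finite P"
    by (rule finite_subset[of _ "{1..k} \<times> {1..k}"]) (auto simp: P_def)
  define f where "f = (\<lambda>(i, j). if i = j then A i i div 2 else A i j)"
  define E where "E = (\<Sum>p\<in>P. replicate_mset (f p) (case p of (i, j) \<Rightarrow> Upair i j))"
  define G where "G = ({1..k}, E)"
  have cnt: "count E (Upair i j) = f (i, j)" if "(i, j) \<in> P" for i j
  proof -
    have "count E (Upair i j) = (\<Sum>p\<in>P. if p = (i, j) then f (i, j) else 0)"
      unfolding E_def count_sum using that
      by (intro sum.cong) (auto simp: P_def)
    also have "\<dots> = f (i, j)" using fP that by simp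
    finally show ?thesis .
  qed
  have "set_uprod e \<subseteq> {1..k}" if "e \<in># E" for e
    using that fP unfolding E_def
    by (auto simp: set_mset_sum P_def split: if_splits)
  then have "multigraph G" by (auto simp: G_def multigraph_def)
  moreover have "A i j = adj G i j" if "i \<in> {1..k}" "j \<in> {1..k}" for i j
  proof (cases "i \<le> j")
    case True
    then show ?thesis
      using that assms cnt[of i j] by (auto simp: P_def G_def adj_def f_def adj_matrices_def)
  next
    case False
    moreover have "Upair i j = Upair j i" by simp
    ultimately show ?thesis
      using that assms cnt[of j i]
      by (auto simp: P_def G_def adj_def f_def adj_matrices_def simp del: Upair_inject)
  qed
  ultimately show ?thesis
    unfolding is_adj_matrix_def
    by (intro exI[of _ "abs_mgraph G"] exI[of _ G] exI[of _ id]) (auto simp: G_def)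
qed

definition mgraph_of_matrix :: "nat \<Rightarrow> (nat \<Rightarrow> nat \<Rightarrow> nat) \<Rightarrow> mgraph" where
  "mgraph_of_matrix k A = (THE F. is_adj_matrix k A F)"

lemma is_adj_matrix_iff:
  assumes "A \<in> adj_matrices k"
  shows "is_adj_matrix k A F \<longleftrightarrow> F = mgraph_of_matrix k A"
  using theI'[of "is_adj_matrix k A"] ex_mgraph_of_adj_matrix[OF assms] is_adj_matrix_unique
  unfolding mgraph_of_matrix_def by metis

definition non_defective :: "(mgraph \<Rightarrow> real) \<Rightarrow> bool" where
  "non_defective f \<longleftrightarrow>
     (\<forall>k A. (\<forall>n. A n \<in> adj_matrices k) \<longrightarrow>
        filterlim (\<lambda>n. edge_count k (A n)) at_top sequentially \<longrightarrow>
        (\<lambda>n. f (mgraph_of_matrix k (A n))) \<longlonglongrightarrow> 0)"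

section \<open>Multigraphons\<close>

text \<open>Only the values of \<open>W x y k\<close> with \<open>x\<close> and \<open>y\<close> in \<open>{0..1}\<close> matter.\<close>

definition multigraphon :: "(real \<Rightarrow> real \<Rightarrow> nat \<Rightarrow> real) \<Rightarrow> bool" where
  "multigraphon W \<longleftrightarrow>
     (\<lambda>(x, y, k). W x y k) \<in> borel_measurable (restrict_space borel ({0..1} \<times> {0..1} \<times> UNIV)) \<and>
     (\<forall>x\<in>{0..1}. \<forall>y\<in>{0..1}.
        (\<forall>k. W x y k \<in> {0..1} \<and> W x y k = W y x k) \<and> (\<lambda>k. W x y k) sums 1) \<and>
     (\<forall>x\<in>{0..1}. \<forall>k. W x x (2 * k + 1) = 0)"

definition tail :: "(real \<Rightarrow> real \<Rightarrow> nat \<Rightarrow> real) \<Rightarrow> real \<Rightarrow> real \<Rightarrow> nat \<Rightarrow> real" where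
  "tail W x y m = (\<Sum>l. W x y (m + l))"

abbreviation unit_lborel :: "real measure" where
  "unit_lborel \<equiv> restrict_space lborel {0..1}"

definition t_le_matrix :: "nat \<Rightarrow> (nat \<Rightarrow> nat \<Rightarrow> nat) \<Rightarrow> (real \<Rightarrow> real \<Rightarrow> nat \<Rightarrow> real) \<Rightarrow> real" where
  "t_le_matrix k A W =
     (LINT x|(\<Pi>\<^sub>M i\<in>{1..k}. unit_lborel). (\<Prod>i=1..k. \<Prod>j=i..k. tail W (x i) (x j) (A i j)))"

text \<open>For a multigraphon, the value does not depend on the choice of the adjacency matrix;
  see \<open>t_le_eq\<close> below.\<close>

definition t_le :: "mgraph \<Rightarrow> (real \<Rightarrow> real \<Rightarrow> nat \<Rightarrow> real) \<Rightarrow> real" where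
  "t_le F W = (SOME t. \<exists>k A. is_adj_matrix k A F \<and> t = t_le_matrix k A W)"

lemma prob_space_unit_lborel: "prob_space unit_lborel"
  by (rule prob_spaceI) (simp add: space_restrict_space emeasure_restrict_space)

lemma measurable_multigraphon:
  assumes W: "multigraphon W" and f: "f \<in> M \<rightarrow>\<^sub>M unit_lborel" and g: "g \<in> M \<rightarrow>\<^sub>M unit_lborel"
  shows "(\<lambda>z. W (f z) (g z) l) \<in> borel_measurable M"
proof -
  have fb: "f \<in> borel_measurable M" "f \<in> space M \<rightarrow> {0..1}"
    using f by (auto simp: measurable_restrict_space2_iff)
  have gb: "g \<in> borel_measurable M" "g \<in> space M \<rightarrow> {0..1}"
    using g by (auto simp: measurable_restrict_space2_iff)
  have "(\<lambda>z. (f z, g z, l)) \<in> M \<rightarrow>\<^sub>M restrict_space borel ({0..1} \<times> {0..1} \<times> UNIV)"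
    using fb gb by (intro measurable_restrict_space2 borel_measurable_Pair) auto
  moreover have "(\<lambda>(x, y, k). W x y k) \<in> borel_measurable (restrict_space borel ({0..1} \<times> {0..1} \<times> UNIV))"
    using W by (simp only: multigraphon_def)
  ultimately have "(\<lambda>z. case (f z, g z, l) of (x, y, k) \<Rightarrow> W x y k) \<in> borel_measurable M"
    by (rule measurable_compose)
  then show ?thesis by simp
qed

lemma measurable_tail:
  assumes "multigraphon W" "f \<in> M \<rightarrow>\<^sub>M unit_lborel" "g \<in> M \<rightarrow>\<^sub>M unit_lborel"
  shows "(\<lambda>z. tail W (f z) (g z) m) \<in> borel_measurable M"
  unfolding tail_def using measurable_multigraphon[OF assms] by (intro borel_measurable_suminf)

lemma prod_upper_triangle_permute:
  fixes h :: "nat \<Rightarrow> nat \<Rightarrow> real"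
  assumes p: "bij_betw p {1..k} {1..k}"
    and h: "\<And>i j. i \<in> {1..k} \<Longrightarrow> j \<in> {1..k} \<Longrightarrow> h i j = h j i"
  shows "(\<Prod>i=1..k. \<Prod>j=i..k. h (p i) (p j)) = (\<Prod>i=1..k. \<Prod>j=i..k. h i j)"
proof -
  let ?q = "inv_into {1..k} p"
  have q: "bij_betw ?q {1..k} {1..k}" using p by (rule bij_betw_inv_into)
  have pI: "p i \<in> {1..k}" "?q (p i) = i" if "i \<in> {1..k}" for i
    using p that by (auto simp: bij_betw_def)
  have qI: "?q i \<in> {1..k}" "p (?q i) = i" if "i \<in> {1..k}" for i
    using p q that by (auto simp: bij_betw_def f_inv_into_f)
  define T where "T = (SIGMA i:{1..k}. {i..k})"
  have T: "(i, j) \<in> T \<longleftrightarrow> i \<in> {1..k} \<and> j \<in> {1..k} \<and> i \<le> j" for i j by (auto simp: T_def)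
  define s :: "(nat \<Rightarrow> nat) \<Rightarrow> nat \<times> nat \<Rightarrow> nat \<times> nat"
    where "s = (\<lambda>r (i, j). (min (r i) (r j), max (r i) (r j)))"
  have mem: "s r z \<in> T" if "z \<in> T" "\<And>i. i \<in> {1..k} \<Longrightarrow> r i \<in> {1..k}" for r z
    using that by (cases z) (auto simp: T s_def min_def max_def)
  have inv: "s r (s r' z) = z" if "z \<in> T" "\<And>i. i \<in> {1..k} \<Longrightarrow> r (r' i) = i" for r r' z
    using that by (cases z) (auto simp: T s_def min_def max_def)
  have "(\<Prod>z\<in>T. case z of (i, j) \<Rightarrow> h (p i) (p j)) = (\<Prod>z\<in>T. case z of (i, j) \<Rightarrow> h i j)"
  proof (rule prod.reindex_bij_witness[of _ "s ?q" "s p"])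
    fix z assume z: "z \<in> T"
    show "s ?q (s p z) = z" using z pI by (intro inv) auto
    show "s p z \<in> T" using z pI by (intro mem) auto
    show "s p (s ?q z) = z" using z qI by (intro inv) auto
    show "s ?q z \<in> T" using z qI by (intro mem) auto
    obtain i j where ij: "z = (i, j)" "i \<in> {1..k}" "j \<in> {1..k}" using z T by (cases z) auto
    then show "(case s p z of (i, j) \<Rightarrow> h i j) = (case z of (i, j) \<Rightarrow> h (p i) (p j))"
      using h[OF pI(1) pI(1), of i j] by (auto simp: s_def min_def max_def)
  qed
  then show ?thesis unfolding T_def by (simp add: prod.Sigma)
qed

lemma t_le_matrix_relabel:
  assumes W: "multigraphon W" and p: "bij_betw p {1..k} {1..k}" and A: "A \<in> adj_matrices k"
    and B: "\<And>i j. i \<in> {1..k} \<Longrightarrow> j \<in> {1..k} \<Longrightarrow> B i j = A (p i) (p j)"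
  shows "t_le_matrix k B W = t_le_matrix k A W"
proof -
  let ?M = "\<Pi>\<^sub>M i\<in>{1..k}. unit_lborel"
  let ?P = "\<lambda>A x. \<Prod>i=1..k. \<Prod>j=i..k. tail W (x i) (x j) (A i j)"
  let ?r = "\<lambda>x. \<lambda>i\<in>{1..k}. x (p i)"
  have pI: "p i \<in> {1..k}" if "i \<in> {1..k}" for i using p that by (auto simp: bij_betw_def)
  have dist: "distr ?M ?M ?r = ?M"
    using p by (intro distr_PiM_reindex prob_space_unit_lborel) (auto simp: bij_betw_def)
  have r: "?r \<in> ?M \<rightarrow>\<^sub>M ?M"
    using pI by (intro measurable_restrict measurable_component_singleton)
  have PB: "?P B \<in> borel_measurable ?M"
    by (intro borel_measurable_prod measurable_tail[OF W] measurable_component_singleton) auto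
  have "t_le_matrix k B W = (LINT x|distr ?M ?M ?r. ?P B x)"
    unfolding dist t_le_matrix_def ..
  also have "\<dots> = (LINT x|?M. ?P B (?r x))"
    using r PB by (rule integral_distr)
  also have "\<dots> = (LINT x|?M. ?P A x)"
  proof (rule Bochner_Integration.integral_cong[OF refl])
    fix x assume x: "x \<in> space ?M"
    have xI: "x i \<in> {0..1}" if "i \<in> {1..k}" for i
      using x that by (auto simp: space_PiM space_restrict_space PiE_iff)
    have "?P B (?r x) = (\<Prod>i=1..k. \<Prod>j=i..k. tail W (x (p i)) (x (p j)) (A (p i) (p j)))"
      using B by (intro prod.cong) auto
    also have "\<dots> = ?P A x"
    proof (rule prod_upper_triangle_permute[OF p])
      fix i j assume ij: "i \<in> {1..k}" "j \<in> {1..k}"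
      have "W (x i) (x j) l = W (x j) (x i) l" for l
        using W xI[OF ij(1)] xI[OF ij(2)] by (auto simp: multigraphon_def)
      then show "tail W (x i) (x j) (A i j) = tail W (x j) (x i) (A j i)"
        using A ij by (auto simp: tail_def adj_matrices_def)
    qed
    finally show "?P B (?r x) = ?P A x" .
  qed
  finally show ?thesis by (simp add: t_le_matrix_def)
qed

lemma t_le_eq:
  assumes W: "multigraphon W" and A: "is_adj_matrix k A F"
  shows "t_le F W = t_le_matrix k A W"
proof -
  have "t_le_matrix m B W = t_le_matrix k A W" if "is_adj_matrix m B F" for m B
    using is_adj_matrix_relabel[OF A that] is_adj_matrix_imp_adj_matrices[OF A]
      t_le_matrix_relabel[OF W] by metis
  moreover have "\<exists>m B. is_adj_matrix m B F \<and> t_le_matrix k A W = t_le_matrix m B W"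
    using A by blast
  ultimately show ?thesis
    unfolding t_le_def by - (rule some_equality, assumption, blast)
qed

definition mg_convergent :: "(nat \<Rightarrow> real \<Rightarrow> real \<Rightarrow> nat \<Rightarrow> real) \<Rightarrow> bool" where
  "mg_convergent W \<longleftrightarrow>
     (\<exists>f. (\<forall>F. (\<lambda>n. t_le F (W n)) \<longlonglongrightarrow> f F) \<and> non_defective f)"

definition mg_tight :: "(nat \<Rightarrow> real \<Rightarrow> real \<Rightarrow> nat \<Rightarrow> real) \<Rightarrow> bool" where
  "mg_tight W \<longleftrightarrow>
     (\<lambda>m. SUP n. LBINT x:{0..1}. LBINT y:{0..1}. tail (W n) x y m) \<longlonglongrightarrow> 0 \<and>
     (\<lambda>m. SUP n. LBINT x:{0..1}. tail (W n) x x m) \<longlonglongrightarrow> 0"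

end

theory Submission
  imports Defs "HOL-Complex_Analysis.Great_Picard"
begin

text \<open>
  Both directions compare the densities \<open>t_le\<close> with two numbers attached to a multigraphon \<open>V\<close>:
  the mean of \<open>tail V x y m\<close> over the square and the mean of \<open>tail V x x m\<close> over the diagonal.
  Since all the factors in the integrand of \<open>t_le\<close> lie in \<open>{0..1}\<close>, the density of a matrix \<open>A\<close> is
  at most the first mean if \<open>A i j \<ge> m\<close> for some \<open>i \<noteq> j\<close>, and at most the second mean if
  \<open>A i i \<ge> m\<close> for some \<open>i\<close> (\<open>t_le_matrix_le\<close>).  Conversely, the two means are themselves densities:
  of two vertices joined by \<open>m\<close> parallel edges, and, for even \<open>m\<close>, of a vertex with \<open>m / 2\<close> loops.

  A convergent sequence is tight: by non-defectiveness the limiting density of one such graph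
  with sufficiently many edges is small, so its density is small for all but finitely many \<open>n\<close>.  Each of
  the remaining multigraphons has tail means tending to zero by dominated convergence, and tails
  decrease in \<open>m\<close>, so the supremum over \<open>n\<close> tends to zero (\<open>SUP_tendsto_0\<close>).

  A tight sequence has a convergent subsequence: there are countably many isomorphism types and
  all densities lie in \<open>{0..1}\<close>, so along some subsequence all densities converge.  If the number of
  edges of matrices of a fixed size tends to infinity, so does their largest entry, and the upper
  bound by the tail means, uniform in \<open>n\<close>, passes to the limit density.  Hence the limit is
  non-defective.
\<close>

section \<open>Tails of a multigraphon\<close>

lemma tail_eq:
  assumes "multigraphon V" "x \<in> {0..1}" "y \<in> {0..1}"
  shows "tail V x y m = 1 - (\<Sum>l<m. V x y l)"
proof -
  have s: "(\<lambda>k. V x y k) sums 1"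
    using assms by (auto simp: multigraphon_def)
  then have "(\<Sum>l. V x y (l + m)) = 1 - (\<Sum>l<m. V x y l)"
    using suminf_minus_initial_segment[of "V x y" m] by (simp add: sums_iff)
  then show ?thesis
    by (simp add: tail_def add.commute)
qed

lemma tail_0:
  assumes "multigraphon V" "x \<in> {0..1}" "y \<in> {0..1}"
  shows "tail V x y 0 = 1"
  using tail_eq[OF assms, of 0] by simp

lemma tail_antimono:
  assumes "multigraphon V" "x \<in> {0..1}" "y \<in> {0..1}" "m \<le> m'"
  shows "tail V x y m' \<le> tail V x y m"
proof -
  have "(\<Sum>l<m. V x y l) \<le> (\<Sum>l<m'. V x y l)"
    using assms by (intro sum_mono2) (auto simp: multigraphon_def)
  then show ?thesis
    by (simp add: tail_eq[OF assms(1-3)])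
qed

lemma tail_tendsto_0:
  assumes "multigraphon V" "x \<in> {0..1}" "y \<in> {0..1}"
  shows "(\<lambda>m. tail V x y m) \<longlonglongrightarrow> 0"
proof -
  have "(\<lambda>k. V x y k) sums 1"
    using assms by (auto simp: multigraphon_def)
  then have "(\<lambda>m. 1 - (\<Sum>l<m. V x y l)) \<longlonglongrightarrow> 1 - 1"
    unfolding sums_def by (intro tendsto_diff tendsto_const)
  then show ?thesis
    by (simp add: tail_eq[OF assms])
qed

lemma tail_bounds:
  assumes "multigraphon V" "x \<in> {0..1}" "y \<in> {0..1}"
  shows "0 \<le> tail V x y m" "tail V x y m \<le> 1"
proof -
  have "decseq (\<lambda>m. tail V x y m)"
    using tail_antimono[OF assms] by (auto simp: decseq_def)
  then show "0 \<le> tail V x y m"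
    using tail_tendsto_0[OF assms] by (rule decseq_ge)
  show "tail V x y m \<le> 1"
    using tail_antimono[OF assms, of 0 m] tail_0[OF assms] by simp
qed

lemma space_unit_lborel: "space unit_lborel = {0..1}"
  by (simp add: space_restrict_space)

lemma integrable_tail:
  assumes "prob_space M" "multigraphon V"
    and f: "f \<in> M \<rightarrow>\<^sub>M unit_lborel" and g: "g \<in> M \<rightarrow>\<^sub>M unit_lborel"
  shows "integrable M (\<lambda>z. tail V (f z) (g z) m)"
proof -
  interpret prob_space M by fact
  have "tail V (f z) (g z) m \<in> {0..1}" if "z \<in> space M" for z
    using tail_bounds[OF assms(2)] measurable_space[OF f that] measurable_space[OF g that]
    by (simp add: space_unit_lborel)
  then show ?thesis
    by (intro integrable_const_bound[where B = 1] AE_I2 measurable_tail[OF assms(2-4)]) fastforce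
qed

lemma integral_tail_tendsto_0:
  assumes "prob_space M" "multigraphon V"
    and f: "f \<in> M \<rightarrow>\<^sub>M unit_lborel" and g: "g \<in> M \<rightarrow>\<^sub>M unit_lborel"
  shows "(\<lambda>m. LINT z|M. tail V (f z) (g z) m) \<longlonglongrightarrow> 0"
proof -
  interpret prob_space M by fact
  have fg: "f z \<in> {0..1}" "g z \<in> {0..1}" if "z \<in> space M" for z
    using measurable_space[OF f that] measurable_space[OF g that]
    by (simp_all add: space_unit_lborel)
  have "(\<lambda>m. LINT z|M. tail V (f z) (g z) m) \<longlonglongrightarrow> (LINT z|M. 0)"
  proof (rule integral_dominated_convergence[where w = "\<lambda>_. 1"])
    show "AE z in M. (\<lambda>m. tail V (f z) (g z) m) \<longlonglongrightarrow> 0"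
      using tail_tendsto_0[OF assms(2) fg] by (intro AE_I2)
    show "AE z in M. norm (tail V (f z) (g z) m) \<le> 1" for m
      using tail_bounds[OF assms(2) fg] by (intro AE_I2) simp
  qed (use measurable_tail[OF assms(2-4)] in auto)
  then show ?thesis by simp
qed

section \<open>Mean tails over the square and over the diagonal\<close>

text \<open>The two integrals in the definition of tightness.\<close>

definition square_tail :: "(real \<Rightarrow> real \<Rightarrow> nat \<Rightarrow> real) \<Rightarrow> nat \<Rightarrow> real" where
  "square_tail V m = (LINT x|unit_lborel. LINT y|unit_lborel. tail V x y m)"

definition diagonal_tail :: "(real \<Rightarrow> real \<Rightarrow> nat \<Rightarrow> real) \<Rightarrow> nat \<Rightarrow> real" where
  "diagonal_tail V m = (LINT x|unit_lborel. tail V x x m)"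

lemma integral_unit_lborel:
  fixes f :: "real \<Rightarrow> real"
  shows "(LINT x|unit_lborel. f x) = (LBINT x:{0..1}. f x)"
  by (simp add: integral_restrict_space set_lebesgue_integral_def)

lemma mg_tight_iff:
  "mg_tight W \<longleftrightarrow>
    (\<lambda>m. SUP n. square_tail (W n) m) \<longlonglongrightarrow> 0 \<and> (\<lambda>m. SUP n. diagonal_tail (W n) m) \<longlonglongrightarrow> 0"
  by (simp add: mg_tight_def square_tail_def diagonal_tail_def integral_unit_lborel)

lemma prob_space_unit_cube: "prob_space (\<Pi>\<^sub>M i\<in>I. unit_lborel)"
  by (intro prob_space_PiM prob_space_unit_lborel)

text \<open>The mean tail over a single pair of coordinates of a cube.  For \<open>i \<noteq> j\<close> the coordinate \<open>j\<close>
  is integrated first; the remaining integrand depends on the coordinate \<open>i\<close> alone.\<close>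

lemma integral_tail_coordinates:
  assumes V: "multigraphon V" and I: "finite I" "i \<in> I" "j \<in> I"
  shows "(LINT x|(\<Pi>\<^sub>M i\<in>I. unit_lborel). tail V (x i) (x j) m) =
    (if i = j then diagonal_tail V m else square_tail V m)"
proof -
  interpret U: prob_space unit_lborel by (rule prob_space_unit_lborel)
  interpret P: product_sigma_finite "\<lambda>_. unit_lborel" ..
  have marginal: "(LINT x|(\<Pi>\<^sub>M i\<in>J. unit_lborel). h (x i)) = (LINT t|unit_lborel. h t)"
    if "i \<in> J" "h \<in> borel_measurable unit_lborel" for J :: "'a set" and h :: "real \<Rightarrow> real"
  proof -
    have "(LINT t|unit_lborel. h t) =
        (LINT t|distr (\<Pi>\<^sub>M i\<in>J. unit_lborel) unit_lborel (\<lambda>x. x i). h t)"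
      by (subst distr_PiM_component) (use that prob_space_unit_lborel in auto)
    also have "\<dots> = (LINT x|(\<Pi>\<^sub>M i\<in>J. unit_lborel). h (x i))"
      using that by (intro integral_distr measurable_component_singleton)
    finally show ?thesis ..
  qed
  show ?thesis
  proof (cases "i = j")
    case True
    have "(\<lambda>t. tail V t t m) \<in> borel_measurable unit_lborel"
      by (intro measurable_tail[OF V]) simp_all
    with True marginal[OF I(2)] show ?thesis
      by (simp add: diagonal_tail_def)
  next
    case False
    define J where "J = I - {j}"
    have J: "finite J" "j \<notin> J" "insert j J = I" "i \<in> J"
      using I False by (auto simp: J_def)
    have int: "integrable (\<Pi>\<^sub>M i\<in>insert j J. unit_lborel) (\<lambda>x. tail V (x i) (x j) m)"
      using J by (intro integrable_tail prob_space_unit_cube V measurable_component_singleton) auto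
    have "(LINT x|(\<Pi>\<^sub>M i\<in>I. unit_lborel). tail V (x i) (x j) m) =
        (LINT x|(\<Pi>\<^sub>M i\<in>J. unit_lborel). LINT y|unit_lborel. tail V (x i) y m)"
      using P.product_integral_insert[OF J(1,2) int] False by (simp add: J(3))
    also have "\<dots> = square_tail V m"
      unfolding square_tail_def
    proof (rule marginal[OF J(4)])
      have "(\<lambda>z. tail V (fst z) (snd z) m) \<in> borel_measurable (unit_lborel \<Otimes>\<^sub>M unit_lborel)"
        by (intro measurable_tail[OF V] measurable_fst measurable_snd)
      then show "(\<lambda>x. LINT y|unit_lborel. tail V x y m) \<in> borel_measurable unit_lborel"
        by (intro U.borel_measurable_lebesgue_integral) (simp add: case_prod_beta')
    qed
    finally show ?thesis using False by simp
  qed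
qed

text \<open>Both means at once: each is the integral of \<open>tail V (x 1) (x j) m\<close> over the square, with
  \<open>j = 2\<close> or \<open>j = 1\<close>.\<close>

lemma mean_tail:
  assumes V: "multigraphon V" and T: "T = square_tail \<or> T = diagonal_tail"
  shows "0 \<le> T V m" "T V m \<le> 1" "m \<le> m' \<Longrightarrow> T V m' \<le> T V m" "(\<lambda>m. T V m) \<longlonglongrightarrow> 0"
proof -
  let ?M = "\<Pi>\<^sub>M i\<in>{1..2::nat}. unit_lborel"
  interpret prob_space ?M by (rule prob_space_unit_cube)
  define j :: nat where "j = (if T = diagonal_tail then 1 else 2)"
  have j: "j \<in> {1..2}" by (simp add: j_def)
  have T_eq: "T V m = (LINT x|?M. tail V (x 1) (x j) m)" for m
    using T by (subst integral_tail_coordinates[OF V]) (auto simp: j_def)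
  have int: "integrable ?M (\<lambda>x. tail V (x 1) (x j) m)" for m
    using j by (intro integrable_tail prob_space_unit_cube V measurable_component_singleton) auto
  have I: "x 1 \<in> {0..1}" "x j \<in> {0..1}" if "x \<in> space ?M" for x
    using that j by (auto simp: space_PiM space_unit_lborel PiE_iff)
  show "0 \<le> T V m"
    unfolding T_eq using tail_bounds[OF V I] by (intro integral_nonneg_AE AE_I2)
  show "T V m \<le> 1"
    unfolding T_eq using tail_bounds[OF V I] int by (intro integral_le_const AE_I2)
  show "T V m' \<le> T V m" if "m \<le> m'"
    unfolding T_eq using tail_antimono[OF V I that] int by (intro integral_mono)
  show "(\<lambda>m. T V m) \<longlonglongrightarrow> 0"
    unfolding T_eq using j
    by (intro integral_tail_tendsto_0 prob_space_unit_cube V measurable_component_singleton) auto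
qed

section \<open>Densities and mean tails\<close>

lemma prod_le_factor:
  fixes h :: "'a \<Rightarrow> real"
  assumes "finite S" "z \<in> S" "\<And>z. z \<in> S \<Longrightarrow> 0 \<le> h z \<and> h z \<le> 1"
  shows "(\<Prod>z\<in>S. h z) \<le> h z"
proof -
  have "(\<Prod>z\<in>S. h z) = h z * (\<Prod>z\<in>S - {z}. h z)"
    using assms by (intro prod.remove)
  also have "\<dots> \<le> h z * 1"
    using assms by (intro mult_left_mono prod_le_1) auto
  finally show ?thesis by simp
qed

lemma t_le_integrand:
  fixes k :: nat
  assumes V: "multigraphon V"
  shows "integrable (\<Pi>\<^sub>M i\<in>{1..k}. unit_lborel)
    (\<lambda>x. \<Prod>i=1..k. \<Prod>j=i..k. tail V (x i) (x j) (A i j))" (is "integrable ?M ?P")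
    and "x \<in> space (\<Pi>\<^sub>M i\<in>{1..k}. unit_lborel) \<Longrightarrow>
      0 \<le> (\<Prod>i=1..k. \<Prod>j=i..k. tail V (x i) (x j) (A i j)) \<and>
      (\<Prod>i=1..k. \<Prod>j=i..k. tail V (x i) (x j) (A i j)) \<le> 1"
proof -
  interpret prob_space ?M by (rule prob_space_unit_cube)
  show P: "0 \<le> ?P x \<and> ?P x \<le> 1" if "x \<in> space ?M" for x
  proof -
    have x: "x i \<in> {0..1}" if "i \<in> {1..k}" for i
      using \<open>x \<in> space ?M\<close> that by (auto simp: space_PiM space_unit_lborel PiE_iff)
    have "0 \<le> tail V (x i) (x j) (A i j) \<and> tail V (x i) (x j) (A i j) \<le> 1"
      if "i \<in> {1..k}" "j \<in> {i..k}" for i j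
    proof -
      have "i \<in> {1..k}" "j \<in> {1..k}"
        using that by simp_all
      then show ?thesis using tail_bounds[OF V x x] by blast
    qed
    then show ?thesis
      by (intro conjI prod_nonneg prod_le_1) blast+
  qed
  have "?P \<in> borel_measurable ?M"
    by (intro borel_measurable_prod measurable_tail[OF V] measurable_component_singleton) auto
  then show "integrable ?M ?P"
    using P by (intro integrable_const_bound[where B = 1] AE_I2) auto
qed

lemma t_le_matrix_bounds:
  assumes "multigraphon V"
  shows "0 \<le> t_le_matrix k A V" "t_le_matrix k A V \<le> 1"
proof -
  interpret prob_space "\<Pi>\<^sub>M i\<in>{1..k}. unit_lborel" by (rule prob_space_unit_cube)
  show "0 \<le> t_le_matrix k A V"
    unfolding t_le_matrix_def using t_le_integrand(2)[OF assms]
    by (intro integral_nonneg_AE AE_I2) blast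
  show "t_le_matrix k A V \<le> 1"
    unfolding t_le_matrix_def using t_le_integrand[OF assms]
    by (intro integral_le_const AE_I2) blast+
qed

lemma t_le_matrix_le:
  assumes V: "multigraphon V" and ij: "1 \<le> i" "i \<le> j" "j \<le> k" and m: "m \<le> A i j"
  shows "t_le_matrix k A V \<le> (if i = j then diagonal_tail V m else square_tail V m)"
proof -
  let ?M = "\<Pi>\<^sub>M i\<in>{1..k}. unit_lborel"
  have "t_le_matrix k A V \<le> (LINT x|?M. tail V (x i) (x j) m)"
    unfolding t_le_matrix_def
  proof (rule integral_mono[OF t_le_integrand(1)[OF V]])
    show "integrable ?M (\<lambda>x. tail V (x i) (x j) m)"
      using ij by (intro integrable_tail prob_space_unit_cube V measurable_component_singleton) auto
    fix x assume "x \<in> space ?M"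
    then have x: "x i \<in> {0..1}" if "i \<in> {1..k}" for i
      using that by (auto simp: space_PiM space_unit_lborel PiE_iff)
    have "(\<Prod>i=1..k. \<Prod>j=i..k. tail V (x i) (x j) (A i j)) =
        (\<Prod>(i, j)\<in>(SIGMA i:{1..k}. {i..k}). tail V (x i) (x j) (A i j))"
      by (simp add: prod.Sigma)
    also have "\<dots> \<le> (case (i, j) of (i, j) \<Rightarrow> tail V (x i) (x j) (A i j))"
      using ij tail_bounds[OF V x x] by (intro prod_le_factor) auto
    also have "\<dots> \<le> tail V (x i) (x j) m"
      using ij m by (auto intro!: tail_antimono[OF V x x])
    finally show "(\<Prod>i=1..k. \<Prod>j=i..k. tail V (x i) (x j) (A i j)) \<le> tail V (x i) (x j) m" .
  qed
  also have "\<dots> = (if i = j then diagonal_tail V m else square_tail V m)"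
    using ij by (intro integral_tail_coordinates[OF V]) auto
  finally show ?thesis .
qed

text \<open>Two vertices joined by \<open>m\<close> edges.\<close>

definition parallel_edges :: "nat \<Rightarrow> nat \<Rightarrow> nat \<Rightarrow> nat" where
  "parallel_edges m i j = (if i = j then 0 else m)"

lemma t_le_matrix_parallel_edges:
  assumes V: "multigraphon V"
  shows "t_le_matrix 2 (parallel_edges m) V = square_tail V m"
proof -
  let ?M = "\<Pi>\<^sub>M i\<in>{1..2::nat}. unit_lborel"
  have "t_le_matrix 2 (parallel_edges m) V = (LINT x|?M. tail V (x 1) (x 2) m)"
    unfolding t_le_matrix_def
  proof (rule Bochner_Integration.integral_cong[OF refl])
    fix x assume "x \<in> space ?M"
    then have x: "x i \<in> {0..1}" if "i \<in> {1..2}" for i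
      using that by (auto simp: space_PiM space_unit_lborel PiE_iff)
    have "{1..2::nat} = {1, 2}" "{2..2::nat} = {2}" by auto
    then show "(\<Prod>i=1..2. \<Prod>j=i..2. tail V (x i) (x j) (parallel_edges m i j)) = tail V (x 1) (x 2) m"
      using tail_0[OF V x x, of 1 1] tail_0[OF V x x, of 2 2] by (simp add: parallel_edges_def)
  qed
  also have "\<dots> = square_tail V m"
    by (subst integral_tail_coordinates[OF V]) auto
  finally show ?thesis .
qed

text \<open>The \<open>1 \<times> 1\<close> matrix with entry \<open>m\<close> is an adjacency matrix only for even \<open>m\<close>, but the identity
  holds for every \<open>m\<close>.\<close>

lemma t_le_matrix_loops:
  assumes V: "multigraphon V"
  shows "t_le_matrix 1 (\<lambda>_ _. m) V = diagonal_tail V m"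
  unfolding t_le_matrix_def using integral_tail_coordinates[OF V, of "{1}" 1 1 m] by (simp del: One_nat_def)

lemma t_le_mgraph_of_matrix:
  assumes "multigraphon V" "A \<in> adj_matrices k"
  shows "t_le (mgraph_of_matrix k A) V = t_le_matrix k A V"
  using assms is_adj_matrix_iff by (intro t_le_eq) auto

section \<open>Convergence implies tightness\<close>

text \<open>Monotonicity in \<open>m\<close> is what lets a single \<open>m\<close> for each \<open>\<epsilon>\<close>, good for all but finitely many
  \<open>n\<close>, suffice in the last hypothesis.\<close>

lemma SUP_tendsto_0:
  fixes t :: "nat \<Rightarrow> nat \<Rightarrow> real"
  assumes bounds: "\<And>n m. 0 \<le> t n m" "\<And>n m. t n m \<le> 1"
    and anti: "\<And>n m m'. m \<le> m' \<Longrightarrow> t n m' \<le> t n m"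
    and lim: "\<And>n. (\<lambda>m. t n m) \<longlonglongrightarrow> 0"
    and small: "\<And>\<epsilon>. \<epsilon> > 0 \<Longrightarrow> \<exists>m. \<forall>\<^sub>F n in sequentially. t n m < \<epsilon>"
  shows "(\<lambda>m. SUP n. t n m) \<longlonglongrightarrow> 0"
proof (rule tendstoI)
  fix e :: real assume "e > 0"
  then have e: "e / 2 > 0" by simp
  obtain m0 N where m0: "\<And>n. n \<ge> N \<Longrightarrow> t n m0 < e / 2"
    using small[OF e] by (auto simp: eventually_sequentially)
  have "\<forall>\<^sub>F m in sequentially. \<forall>n\<in>{..<N}. t n m < e / 2"
    using order_tendstoD(2)[OF lim e] by (simp add: eventually_ball_finite)
  then show "\<forall>\<^sub>F m in sequentially. dist (SUP n. t n m) 0 < e"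
    using eventually_ge_at_top[of m0]
  proof eventually_elim
    case (elim m)
    have "t n m \<le> e / 2" for n
      using elim m0[of n] anti[of m0 m n] by (cases "n < N") (auto intro: less_imp_le)
    then have "(SUP n. t n m) \<le> e / 2"
      by (intro cSUP_least) auto
    moreover have "0 \<le> (SUP n. t n m)"
      using bounds by (intro cSUP_upper2[of _ _ 0] bdd_aboveI2[where M = 1]) auto
    ultimately show ?case
      using \<open>e > 0\<close> by (simp add: dist_real_def)
  qed
qed

lemma mg_convergent_imp_small_density:
  assumes W: "\<And>n. multigraphon (W n)" and conv: "mg_convergent W"
    and A: "\<And>m. A m \<in> adj_matrices k"
    and e: "filterlim (\<lambda>m. edge_count k (A m)) at_top sequentially"
    and "\<epsilon> > 0"
  shows "\<exists>m. \<forall>\<^sub>F n in sequentially. t_le_matrix k (A m) (W n) < \<epsilon>"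
proof -
  obtain f where f: "\<And>F. (\<lambda>n. t_le F (W n)) \<longlonglongrightarrow> f F" and nd: "non_defective f"
    using conv by (auto simp: mg_convergent_def)
  have "(\<lambda>m. f (mgraph_of_matrix k (A m))) \<longlonglongrightarrow> 0"
    using nd A e unfolding non_defective_def by blast
  then obtain m where "f (mgraph_of_matrix k (A m)) < \<epsilon>"
    using order_tendstoD(2) \<open>\<epsilon> > 0\<close> eventually_happens' sequentially_bot by metis
  then have "\<forall>\<^sub>F n in sequentially. t_le (mgraph_of_matrix k (A m)) (W n) < \<epsilon>"
    using f order_tendstoD(2) by metis
  then show ?thesis
    using t_le_mgraph_of_matrix[OF W A] by auto
qed

lemma mg_convergent_imp_mg_tight:
  assumes W: "\<And>n. multigraphon (W n)" and conv: "mg_convergent W"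
  shows "mg_tight W"
  unfolding mg_tight_iff
proof
  show "(\<lambda>m. SUP n. square_tail (W n) m) \<longlonglongrightarrow> 0"
  proof (rule SUP_tendsto_0)
    fix \<epsilon> :: real assume "\<epsilon> > 0"
    have "edge_count 2 (parallel_edges m) = real m" for m
    proof -
      have "{1..2::nat} = {1, 2}" by auto
      then show ?thesis by (simp add: edge_count_def parallel_edges_def)
    qed
    then have "\<exists>m. \<forall>\<^sub>F n in sequentially. t_le_matrix 2 (parallel_edges m) (W n) < \<epsilon>"
      by (intro mg_convergent_imp_small_density[OF W conv _ _ \<open>\<epsilon> > 0\<close>])
         (simp_all add: filterlim_real_sequentially adj_matrices_def parallel_edges_def)
    then show "\<exists>m. \<forall>\<^sub>F n in sequentially. square_tail (W n) m < \<epsilon>"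
      by (simp add: t_le_matrix_parallel_edges[OF W])
  qed (use mean_tail[OF W, of square_tail] in auto)
  show "(\<lambda>m. SUP n. diagonal_tail (W n) m) \<longlonglongrightarrow> 0"
  proof (rule SUP_tendsto_0)
    fix \<epsilon> :: real assume "\<epsilon> > 0"
    \<comment> \<open>Diagonal entries must be even, so only the tails from even positions are densities of graphs.\<close>
    have "edge_count 1 (\<lambda>_ _. 2 * m) = real m" for m
      by (simp add: edge_count_def)
    then have "\<exists>m. \<forall>\<^sub>F n in sequentially. t_le_matrix 1 (\<lambda>_ _. 2 * m) (W n) < \<epsilon>"
      by (intro mg_convergent_imp_small_density[OF W conv _ _ \<open>\<epsilon> > 0\<close>])
         (simp_all add: filterlim_real_sequentially adj_matrices_def)
    then show "\<exists>m. \<forall>\<^sub>F n in sequentially. diagonal_tail (W n) m < \<epsilon>"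
      unfolding t_le_matrix_loops[OF W] by blast
  qed (use mean_tail[OF W, of diagonal_tail] in auto)
qed

section \<open>Compactness of tight sequences\<close>

lemma countable_mgraph: "countable (UNIV :: mgraph set)"
proof -
  let ?g = "\<lambda>(k, xs :: nat list list). mgraph_of_matrix k (\<lambda>i j. xs ! i ! j)"
  have "F \<in> range ?g" for F
  proof -
    obtain k A where A: "is_adj_matrix k A F"
      using ex_is_adj_matrix by blast
    \<comment> \<open>The list entries with index 0 are padding, since matrix indices start at 1.\<close>
    define xs where "xs = map (\<lambda>i. map (A i) [0..<Suc k]) [0..<Suc k]"
    have "xs ! i ! j = A i j" if "i \<in> {1..k}" "j \<in> {1..k}" for i j
      using that by (auto simp: xs_def simp del: upt_Suc)
    with A have "is_adj_matrix k (\<lambda>i j. xs ! i ! j) F"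
      unfolding is_adj_matrix_def by (metis (no_types, lifting))
    then have "F = ?g (k, xs)"
      using is_adj_matrix_iff is_adj_matrix_imp_adj_matrices by (metis case_prod_conv)
    then show ?thesis by blast
  qed
  then have "UNIV = range ?g" by blast
  then show ?thesis by (metis countable_image uncountable_def countableI_type)
qed

lemma ex_large_entry:
  assumes A: "A \<in> adj_matrices k" and e: "edge_count k A > real (k * k * m)"
  shows "\<exists>i j. 1 \<le> i \<and> i \<le> j \<and> j \<le> k \<and> m \<le> A i j"
proof (rule ccontr)
  assume neg: "\<not> ?thesis"
  have "A i j \<le> m" if "i \<in> {1..k}" "j \<in> {1..k}" for i j
  proof (cases "i \<le> j")
    case True
    then show ?thesis using neg that by (meson atLeastAtMost_iff nat_le_linear)
  next
    case False
    then have "A j i \<le> m" using neg that by (meson atLeastAtMost_iff nat_le_linear)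
    then show ?thesis using A that by (auto simp: adj_matrices_def)
  qed
  then have "(\<Sum>i=1..k. \<Sum>j=1..k. real (A i j)) \<le> (\<Sum>i=1..k. \<Sum>j=1..k. real m)"
    by (intro sum_mono) auto
  then have "edge_count k A \<le> (1/2) * real (k * k * m)"
    by (simp add: edge_count_def)
  moreover have "(1/2) * real (k * k * m) \<le> real (k * k * m)"
    by simp
  ultimately show False using e by linarith
qed

lemma mg_tight_imp_convergent_subsequence:
  assumes W: "\<And>n. multigraphon (W n)" and tight: "mg_tight W"
  shows "\<exists>r::nat \<Rightarrow> nat. strict_mono r \<and> mg_convergent (\<lambda>n. W (r n))"
proof -
  have t_le_bounds: "0 \<le> t_le F (W n)" "t_le F (W n) \<le> 1" for F n
    using t_le_eq[OF W] t_le_matrix_bounds[OF W] ex_is_adj_matrix by metis+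
  obtain r :: "nat \<Rightarrow> nat" where r: "strict_mono r"
    and "\<And>F. F \<in> UNIV \<Longrightarrow> \<exists>l. (\<lambda>n. t_le F (W (r n))) \<longlonglongrightarrow> l"
    using function_convergent_subsequence[OF countable_mgraph, of "\<lambda>n F. t_le F (W n)" 1]
      t_le_bounds by auto
  then obtain f where f: "\<And>F. (\<lambda>n. t_le F (W (r n))) \<longlonglongrightarrow> f F"
    by (metis UNIV_I)
  define g where "g m = max (SUP n. diagonal_tail (W n) m) (SUP n. square_tail (W n) m)" for m
  have "g \<longlonglongrightarrow> max 0 0"
    unfolding g_def using tight mg_tight_iff by (intro tendsto_max) auto
  then have g: "g \<longlonglongrightarrow> 0" by simp
  have le_SUP: "T (W n) m \<le> (SUP n. T (W n) m)" if "T = square_tail \<or> T = diagonal_tail" for T n m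
    using mean_tail(2)[OF W that] by (intro cSUP_upper bdd_aboveI2[where M = 1]) auto
  then have le_g: "diagonal_tail (W n) m \<le> g m" "square_tail (W n) m \<le> g m" for n m
    by (simp_all add: g_def le_max_iff_disj)
  have f_le_g: "f (mgraph_of_matrix k A) \<le> g m"
    if "A \<in> adj_matrices k" "1 \<le> i" "i \<le> j" "j \<le> k" "m \<le> A i j" for A k i j m
  proof (rule LIMSEQ_le_const2[OF f], intro exI allI impI)
    fix n
    show "t_le (mgraph_of_matrix k A) (W (r n)) \<le> g m"
      using t_le_matrix_le[where V = "W (r n)" and A = A, OF W that(2-5)] le_g[of "r n" m]
        t_le_mgraph_of_matrix[OF W that(1), of "r n"] by (auto split: if_splits)
  qed
  have "non_defective f"
    unfolding non_defective_def
  proof (intro allI impI)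
    fix k A
    assume A: "\<forall>n. A n \<in> adj_matrices k"
      and e: "filterlim (\<lambda>n. edge_count k (A n)) at_top sequentially"
    show "(\<lambda>n. f (mgraph_of_matrix k (A n))) \<longlonglongrightarrow> 0"
    proof (rule tendstoI)
      fix \<epsilon> :: real assume "\<epsilon> > 0"
      then obtain m where m: "g m < \<epsilon>"
        using order_tendstoD(2)[OF g] eventually_happens' sequentially_bot by metis
      have "\<forall>\<^sub>F n in sequentially. edge_count k (A n) > real (k * k * m)"
        using e unfolding filterlim_at_top_dense by blast
      then show "\<forall>\<^sub>F n in sequentially. dist (f (mgraph_of_matrix k (A n))) 0 < \<epsilon>"
      proof eventually_elim
        case (elim n)
        then obtain i j where "1 \<le> i" "i \<le> j" "j \<le> k" "m \<le> A n i j"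
          using ex_large_entry A by blast
        then have "f (mgraph_of_matrix k (A n)) \<le> g m"
          using f_le_g A by blast
        moreover have "0 \<le> f (mgraph_of_matrix k (A n))"
          using t_le_bounds by (intro LIMSEQ_le_const[OF f]) auto
        ultimately show ?case using m by simp
      qed
    qed
  qed
  with r f show ?thesis
    unfolding mg_convergent_def by blast
qed

theorem proposition2:
  fixes W :: "nat \<Rightarrow> real \<Rightarrow> real \<Rightarrow> nat \<Rightarrow> real"
  assumes "\<And>n. multigraphon (W n)"
  shows "(mg_convergent W \<longrightarrow> mg_tight W) \<and>
    (mg_tight W \<longrightarrow> (\<exists>r::nat \<Rightarrow> nat. strict_mono r \<and> mg_convergent (\<lambda>n. W (r n))))"
  using mg_convergent_imp_mg_tight[of W, OF assms] mg_tight_imp_convergent_subsequence[of W, OF assms]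
  by blast

end
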